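(* For a cognitive network with $K>1$ cognitive users and $N$ channels with probabilities $\theta=(\theta_1,\dots,\theta_N)$ of being free, the optimal symmetric strategy $\mathbf p^*=(p_1^*,\dots,p_N^* )$, i.e. the probability vector maximizing the expected per-user throughput $W(\mathbf p)$ over all $\mathbf p\ge\mathbf 0$ with $\sum_{i=1}^N p_i=1$, is given by $$p_i^*=\begin{cases}\left\{1-\left(\dfrac{\lambda^*}{K\theta_i}\right)^{1/(K-1)}\right\}^{+}, & \text{for }\theta_i>0,\\[2mm] 0,&\text{for }\theta_i=0,\end{cases}$$ where $\lambda^*$ is a constant such that $\sum_{i=1}^N p_i^*=1$, and $\{x\}^+=\max\{0,x\}$.
   Context: There are $N$ channels, $K$ users and $T$ time slots; $B$ is the number of bits that can be sent over a free channel in one slot. In each slot, channel $i$ is free with probability $\theta_i$, independently over channels and slots, and $\theta$ is known to all users. In each slot every user, independently of the other users and of the channel states, chooses one channel to sense, choosing channel $i$ with probability $p_i$ (the same vector $\mathbf p=(p_1,\dots,p_N)$ for all users: a symmetric strategy). If channel $i$ is free in a slot, then exactly one of the users who chose channel $i$ in that slot, each being equally likely, transmits $B$ bits on it; the other users transmit nothing on it. If channel $i$ is not free, nobody transmits on it. $W(\mathbf p)$ is the expected total number of bits transmitted by a given user over the $T$ slots (it is the same for all users). *)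

theory Defs
  imports "HOL-Analysis.Analysis" "HOL-Probability.Probability" "HOL-Probability.Product_PMF"
begin

text \<open>
  The channels are the elements of the finite type \<open>'n\<close> (so \<open>N = CARD('n)\<close>), the users are
  \<open>0, \<dots>, K - 1\<close> and the slots are \<open>0, \<dots>, T - 1\<close>.
\<close>

definition prob_vectors :: "(real ^ 'n) set" where
  "prob_vectors = {p. (\<forall>i. 0 \<le> p $ i) \<and> (\<Sum>i\<in>UNIV. p $ i) = 1}"

definition channel_states_pmf :: "real ^ 'n \<Rightarrow> ('n::finite \<Rightarrow> bool) pmf" where
  "channel_states_pmf \<theta> = Pi_pmf UNIV False (\<lambda>i. bernoulli_pmf (\<theta> $ i))"

text \<open>Meaningful only for \<open>p \<in> prob_vectors\<close>, as required by \<^const>\<open>embed_pmf\<close>.\<close>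

definition choices_pmf :: "nat \<Rightarrow> real ^ 'n \<Rightarrow> (nat \<Rightarrow> 'n::finite) pmf" where
  "choices_pmf K p = Pi_pmf {..<K} undefined (\<lambda>_. embed_pmf (\<lambda>i. p $ i))"

definition contenders :: "nat \<Rightarrow> (nat \<Rightarrow> 'n) \<Rightarrow> 'n \<Rightarrow> nat set" where
  "contenders K c i = {k. k < K \<and> c k = i}"

definition winner_pmf :: "nat \<Rightarrow> (nat \<Rightarrow> 'n) \<Rightarrow> 'n \<Rightarrow> nat option pmf" where
  "winner_pmf K c i =
     (if contenders K c i = {} then return_pmf None
      else map_pmf Some (pmf_of_set (contenders K c i)))"

text \<open>
  The outcome of one slot: which channels are free, and for each channel which of the users
  sensing it (if any) is entitled to transmit on it in case it is free.
  Given the choices, the winners on different channels are drawn independently; this joint law has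
  no influence on expected throughputs.
\<close>

definition slot_pmf ::
    "nat \<Rightarrow> real ^ 'n \<Rightarrow> real ^ 'n \<Rightarrow> (('n::finite \<Rightarrow> bool) \<times> ('n \<Rightarrow> nat option)) pmf" where
  "slot_pmf K \<theta> p =
     pair_pmf (channel_states_pmf \<theta>)
       (bind_pmf (choices_pmf K p) (\<lambda>c. Pi_pmf UNIV None (winner_pmf K c)))"

definition slot_bits ::
    "real \<Rightarrow> nat \<Rightarrow> ('n::finite \<Rightarrow> bool) \<times> ('n \<Rightarrow> nat option) \<Rightarrow> real" where
  "slot_bits B u = (\<lambda>(free, winner). \<Sum>i\<in>UNIV. if free i \<and> winner i = Some u then B else 0)"

definition throughput ::
    "nat \<Rightarrow> nat \<Rightarrow> real \<Rightarrow> real ^ 'n \<Rightarrow> nat \<Rightarrow> real ^ 'n::finite \<Rightarrow> real" where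
  "throughput K T B \<theta> u p =
     measure_pmf.expectation (Pi_pmf {..<T} undefined (\<lambda>_. slot_pmf K \<theta> p))
       (\<lambda>\<omega>. \<Sum>t<T. slot_bits B u (\<omega> t))"

definition water_filling :: "nat \<Rightarrow> real ^ 'n \<Rightarrow> real \<Rightarrow> real ^ 'n" where
  "water_filling K \<theta> l =
     (\<chi> i. if \<theta> $ i > 0
          then max 0 (1 - (l / (real K * \<theta> $ i)) powr (1 / (real K - 1)))
          else 0)"

end

theory Submission
  imports Defs
begin

text \<open>
  By exchangeability of the users, a given user wins channel \<open>i\<close> with probability
  \<open>(1 - (1 - p\<^sub>i)\<^sup>K) / K\<close>, so \<open>W(p) = (T B / K) \<Sum>\<^sub>i \<theta>\<^sub>i (1 - (1 - p\<^sub>i)\<^sup>K)\<close>. Each summand is strictly concave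
  when \<open>\<theta>\<^sub>i > 0\<close>, and at a water-filling vector its tangent has slope \<open>\<lambda>\<close> if \<open>p\<^sub>i > 0\<close> and slope at most
  \<open>\<lambda>\<close> if \<open>p\<^sub>i = 0\<close>. Summing the tangent inequalities shows that the water-filling vector is
  the unique maximizer on the simplex.
\<close>

subsection \<open>The throughput of a symmetric strategy\<close>

lemma pmf_embed_pmf_prob_vectors:
  fixes p :: "real ^ 'n"
  assumes "p \<in> prob_vectors"
  shows "pmf (embed_pmf (\<lambda>i. p $ i)) i = p $ i"
proof (rule pmf_embed_pmf)
  show "(\<integral>\<^sup>+ i. ennreal (p $ i) \<partial>count_space UNIV) = 1"
    using assms by (simp add: prob_vectors_def nn_integral_count_space_finite)
qed (use assms in \<open>simp add: prob_vectors_def\<close>)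

text \<open>Law of the winner on a single channel with the choices averaged out. Bits add up over
  channels, so by linearity these marginals suffice for the throughput.\<close>

definition channel_winner_pmf :: "nat \<Rightarrow> real ^ 'n \<Rightarrow> 'n::finite \<Rightarrow> nat option pmf" where
  "channel_winner_pmf K p i = bind_pmf (choices_pmf K p) (\<lambda>c. winner_pmf K c i)"

lemma finite_contenders [simp]: "finite (contenders K c i)"
  by (simp add: contenders_def)

lemma set_winner_pmf: "set_pmf (winner_pmf K c i) \<subseteq> insert None (Some ` {..<K})"
  by (auto simp: winner_pmf_def contenders_def)

section \<open>Exchangeability of the users\<close>

lemma contenders_comp:
  assumes "bij \<pi>" and "\<And>k. \<pi> k < K \<longleftrightarrow> k < K"
  shows "contenders K (c \<circ> \<pi>) i = inv \<pi> ` contenders K c i"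
proof -
  have "contenders K (c \<circ> \<pi>) i = \<pi> -` contenders K c i"
    by (auto simp: contenders_def assms(2))
  with assms(1) show ?thesis
    by (simp add: bij_vimage_eq_inv_image)
qed

text \<open>An injection carries a uniform law to the uniform law on its image, so relabelling the
  users before the draw amounts to relabelling the drawn winner.\<close>

lemma winner_pmf_comp:
  assumes "bij \<pi>" and "\<And>k. \<pi> k < K \<longleftrightarrow> k < K"
  shows "winner_pmf K (c \<circ> \<pi>) i = map_pmf (map_option (inv \<pi>)) (winner_pmf K c i)"
proof (cases "contenders K c i = {}")
  case False
  have "inj_on (inv \<pi>) (contenders K c i)"
    using assms(1) by (meson bij_imp_bij_inv bij_is_inj inj_on_subset subset_UNIV)
  then have "pmf_of_set (inv \<pi> ` contenders K c i) = map_pmf (inv \<pi>) (pmf_of_set (contenders K c i))"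
    using False by (simp add: map_pmf_of_set_inj)
  with False show ?thesis
    by (simp add: winner_pmf_def contenders_comp[OF assms] map_pmf_comp)
qed (simp add: winner_pmf_def contenders_comp[OF assms])

lemma choices_pmf_permute:
  assumes "bij \<pi>" and "\<And>k. \<pi> k < K \<longleftrightarrow> k < K"
  shows "map_pmf (\<lambda>c. c \<circ> \<pi>) (choices_pmf K p) = choices_pmf K p"
proof -
  have "bij_betw \<pi> {..<K} {..<K}"
  proof (rule bij_betw_imageI)
    show "inj_on \<pi> {..<K}"
      using assms(1) by (meson bij_is_inj inj_on_subset subset_UNIV)
    have "\<pi> -` {..<K} = {..<K}"
      by (auto simp: assms(2))
    then show "\<pi> ` {..<K} = {..<K}"
      using assms(1) by (metis bij_is_surj surj_image_vimage_eq)
  qed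
  with assms(2) show ?thesis
    unfolding choices_pmf_def by (intro Pi_pmf_bij_betw[symmetric]) auto
qed

text \<open>The users choose independently with one common law, so swapping \<open>u\<close> and
  \<open>v\<close> preserves the law of the choices. Hence the winner's law is invariant under the
  swap, which is its own inverse.\<close>

lemma channel_winner_pmf_symmetric:
  assumes "u < K" and "v < K"
  shows "pmf (channel_winner_pmf K p i) (Some u) = pmf (channel_winner_pmf K p i) (Some v)"
proof -
  define \<pi> where "\<pi> = Transposition.transpose u v"
  have \<pi>: "bij \<pi>" "\<And>k. \<pi> k < K \<longleftrightarrow> k < K" "inv \<pi> = \<pi>"
    using assms by (auto simp: \<pi>_def Transposition.transpose_def)
  have "channel_winner_pmf K p i
      = bind_pmf (map_pmf (\<lambda>c. c \<circ> \<pi>) (choices_pmf K p)) (\<lambda>c. winner_pmf K c i)"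
    by (simp only: channel_winner_pmf_def choices_pmf_permute[OF \<pi>(1,2)])
  also have "\<dots> = bind_pmf (choices_pmf K p) (\<lambda>c. winner_pmf K (c \<circ> \<pi>) i)"
    by (simp add: bind_map_pmf)
  also have "\<dots> = map_pmf (map_option \<pi>) (channel_winner_pmf K p i)"
    by (simp add: winner_pmf_comp[OF \<pi>(1,2)] \<pi>(3) channel_winner_pmf_def map_bind_pmf)
  finally have "pmf (channel_winner_pmf K p i) (map_option \<pi> (Some v))
      = pmf (map_pmf (map_option \<pi>) (channel_winner_pmf K p i)) (map_option \<pi> (Some v))"
    by simp
  also have "\<dots> = pmf (channel_winner_pmf K p i) (Some v)"
    using \<pi>(1) by (intro pmf_map_inj') (simp add: bij_is_inj option.inj_map)
  finally show ?thesis
    by (simp add: \<pi>_def)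
qed

section \<open>Law of the winner on one channel\<close>

lemma pmf_channel_winner_None:
  assumes "p \<in> prob_vectors"
  shows "pmf (channel_winner_pmf K p i) None = (1 - p $ i) ^ K"
proof -
  \<comment> \<open>Given the choices, \<open>None\<close> has mass 1 if every user avoids channel
    \<open>i\<close> and mass 0 otherwise.\<close>
  have "pmf (channel_winner_pmf K p i) None
      = measure_pmf.expectation (choices_pmf K p) (indicator (Pi {..<K} (\<lambda>_. - {i})))"
    unfolding channel_winner_pmf_def pmf_bind
    by (intro Bochner_Integration.integral_cong)
       (auto simp: winner_pmf_def contenders_def indicator_def Pi_def pmf_eq_0_set_pmf)
  also have "\<dots> = measure_pmf.prob (choices_pmf K p) (Pi {..<K} (\<lambda>_. - {i}))"
    by simp
  also have "\<dots> = (\<Prod>k<K. measure_pmf.prob (embed_pmf (\<lambda>i. p $ i)) (- {i}))"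
    unfolding choices_pmf_def by (rule measure_Pi_pmf_Pi) simp
  also have "measure_pmf.prob (embed_pmf (\<lambda>i. p $ i)) (- {i}) = 1 - p $ i"
    using measure_pmf.prob_compl[of "{i}" "embed_pmf (\<lambda>i. p $ i)"]
    by (simp add: Compl_eq_Diff_UNIV measure_pmf_single pmf_embed_pmf_prob_vectors[OF assms])
  finally show ?thesis
    by simp
qed

text \<open>The mass left over by \<open>None\<close> is shared equally by the \<open>K\<close>
  users; this avoids averaging the reciprocal of the number of contenders.\<close>

lemma pmf_channel_winner_Some:
  assumes "p \<in> prob_vectors" and "u < K"
  shows "pmf (channel_winner_pmf K p i) (Some u) = (1 - (1 - p $ i) ^ K) / K"
proof -
  let ?Q = "channel_winner_pmf K p i"
  have subset: "set_pmf ?Q \<subseteq> insert None (Some ` {..<K})"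
    unfolding channel_winner_pmf_def set_bind_pmf by (intro UN_least set_winner_pmf)
  have "1 = (\<Sum>x\<in>insert None (Some ` {..<K}). pmf ?Q x)"
    by (rule sum_pmf_eq_1[OF _ subset, symmetric]) simp
  also have "\<dots> = pmf ?Q None + (\<Sum>v<K. pmf ?Q (Some v))"
    by (subst sum.insert) (auto simp: sum.reindex)
  also have "(\<Sum>v<K. pmf ?Q (Some v)) = (\<Sum>v<K. pmf ?Q (Some u))"
    by (intro sum.cong channel_winner_pmf_symmetric) (use assms(2) in auto)
  finally show ?thesis
    using assms by (simp add: pmf_channel_winner_None field_simps)
qed

section \<open>Expected bits in one slot and over all slots\<close>

lemma slot_pmf_marginal:
  "map_pmf (\<lambda>(free, winner). (free i, winner i)) (slot_pmf K \<theta> p)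
    = pair_pmf (bernoulli_pmf (\<theta> $ i)) (channel_winner_pmf K p i)"
  by (simp add: slot_pmf_def map_pair channel_states_pmf_def channel_winner_pmf_def
      map_bind_pmf Pi_pmf_component)

text \<open>Finite support provides the integrability behind each use of linearity of
  expectation.\<close>

lemma finite_set_slot_pmf: "finite (set_pmf (slot_pmf K \<theta> p))"
proof -
  have "finite (set_pmf (winner_pmf K c i))" for c :: "nat \<Rightarrow> 'n" and i
    by (rule finite_subset[OF set_winner_pmf]) simp
  then show ?thesis
    unfolding slot_pmf_def channel_states_pmf_def choices_pmf_def set_pair_pmf set_bind_pmf
    by (intro finite_cartesian_product finite_UN_I)
       (auto simp: set_Pi_pmf intro!: finite_PiE_dflt)
qed

lemma expectation_slot_bits:
  assumes "p \<in> prob_vectors" and "u < K" and "\<forall>i. 0 \<le> \<theta> $ i \<and> \<theta> $ i \<le> 1"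
  shows "measure_pmf.expectation (slot_pmf K \<theta> p) (slot_bits B u)
      = B / K * (\<Sum>i\<in>UNIV. \<theta> $ i * (1 - (1 - p $ i) ^ K))"
proof -
  \<comment> \<open>Each summand becomes an indicator of one point under the projection to channel
    \<open>i\<close>, so its expectation is a point mass of the marginal law.\<close>
  have bits: "slot_bits B u
      = (\<lambda>x. \<Sum>i\<in>UNIV. B * indicator {(True, Some u)} ((\<lambda>(free, winner). (free i, winner i)) x))"
    unfolding slot_bits_def by (intro ext, clarify, intro sum.cong) (auto simp: indicator_def)
  have "measure_pmf.expectation (slot_pmf K \<theta> p) (slot_bits B u)
      = (\<Sum>i\<in>UNIV. B * measure_pmf.expectation (slot_pmf K \<theta> p)
          (\<lambda>x. indicator {(True, Some u)} ((\<lambda>(free, winner). (free i, winner i)) x)))"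
    unfolding bits
    by (subst Bochner_Integration.integral_sum)
       (auto intro!: integrable_measure_pmf_finite finite_set_slot_pmf)
  also have "\<dots> = (\<Sum>i\<in>UNIV. B * pmf (pair_pmf (bernoulli_pmf (\<theta> $ i)) (channel_winner_pmf K p i))
      (True, Some u))"
    by (subst integral_map_pmf[symmetric]) (simp add: slot_pmf_marginal measure_pmf_single)
  also have "\<dots> = (\<Sum>i\<in>UNIV. B / K * (\<theta> $ i * (1 - (1 - p $ i) ^ K)))"
    using assms by (simp add: pmf_pair pmf_channel_winner_Some)
  finally show ?thesis
    by (simp add: sum_distrib_left)
qed

lemma throughput_eq:
  assumes "p \<in> prob_vectors" and "u < K" and "\<forall>i. 0 \<le> \<theta> $ i \<and> \<theta> $ i \<le> 1"
  shows "throughput K T B \<theta> u p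
      = T * B / K * (\<Sum>i\<in>UNIV. \<theta> $ i * (1 - (1 - p $ i) ^ K))"
proof -
  let ?P = "Pi_pmf {..<T} undefined (\<lambda>_. slot_pmf K \<theta> p)"
  have "finite (set_pmf ?P)"
    by (auto simp: set_Pi_pmf finite_set_slot_pmf)
  then have "throughput K T B \<theta> u p
      = (\<Sum>t<T. measure_pmf.expectation ?P (\<lambda>\<omega>. slot_bits B u (\<omega> t)))"
    unfolding throughput_def
    by (intro Bochner_Integration.integral_sum integrable_measure_pmf_finite)
  also have "\<dots> = (\<Sum>t<T. measure_pmf.expectation (map_pmf (\<lambda>\<omega>. \<omega> t) ?P) (slot_bits B u))"
    by simp
  also have "\<dots> = (\<Sum>t<T. measure_pmf.expectation (slot_pmf K \<theta> p) (slot_bits B u))"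
    by (simp add: Pi_pmf_component del: integral_map_pmf)
  finally show ?thesis
    by (simp add: expectation_slot_bits[OF assms])
qed

subsection \<open>Water-filling\<close>

text \<open>Strict convexity of powers, by induction on the exponent after multiplying by
  \<open>b\<close>. The exponent starts at 2 because exponent 1 gives equality.\<close>

lemma power_gt_tangent:
  fixes a b :: real
  assumes "0 \<le> a" "0 \<le> b" "a \<noteq> b"
  shows "b ^ Suc (Suc n) > a ^ Suc (Suc n) + real (Suc (Suc n)) * a ^ Suc n * (b - a)"
proof (induction n)
  case 0
  have "(b - a)\<^sup>2 > 0"
    using assms by simp
  then show ?case
    by (simp add: power2_eq_square algebra_simps)
next
  case (Suc n)
  show ?case
  \<comment> \<open>Multiplying by \<open>b = 0\<close> would lose strictness; here the claim
    reduces to positivity of a multiple of a power of \<open>a\<close>.\<close>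
  proof (cases "b = 0")
    case True
    with assms have "a > 0" by simp
    then have "real (Suc (Suc n)) * a ^ Suc (Suc (Suc n)) > 0"
      by simp
    with True show ?thesis
      by (simp add: algebra_simps)
  next
    case False
    with assms have "b * b ^ Suc (Suc n)
        > b * (a ^ Suc (Suc n) + real (Suc (Suc n)) * a ^ Suc n * (b - a))"
      using Suc.IH by (intro mult_strict_left_mono) auto
    \<comment> \<open>Writing \<open>b = a + (b - a)\<close> yields the next tangent plus a
      nonnegative square term.\<close>
    moreover have "b * (a ^ Suc (Suc n) + real (Suc (Suc n)) * a ^ Suc n * (b - a))
        = a ^ Suc (Suc (Suc n)) + real (Suc (Suc (Suc n))) * a ^ Suc (Suc n) * (b - a)
          + real (Suc (Suc n)) * a ^ Suc n * (b - a)\<^sup>2"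
      by (simp add: algebra_simps power2_eq_square)
    moreover have "real (Suc (Suc n)) * a ^ Suc n * (b - a)\<^sup>2 \<ge> 0"
      using assms by simp
    ultimately show ?thesis
      by simp
  qed
qed

lemma power_complement_less_tangent:
  fixes x y :: real
  assumes "K > 1" "x \<le> 1" "y \<le> 1" "x \<noteq> y"
  shows "1 - (1 - y) ^ K < 1 - (1 - x) ^ K + K * (1 - x) ^ (K - 1) * (y - x)"
proof -
  obtain n where K: "K = Suc (Suc n)"
    using assms(1) that[of "K - 2"] by simp
  have "(1 - y) ^ K > (1 - x) ^ K + K * (1 - x) ^ (K - 1) * ((1 - y) - (1 - x))"
    using power_gt_tangent[of "1 - x" "1 - y" n] assms(2-4) by (simp add: K del: power_Suc of_nat_Suc)
  then show ?thesis
    by (simp add: right_diff_distrib)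
qed

section \<open>Optimality of water-filling vectors\<close>

lemma water_filling_nonneg: "0 \<le> water_filling K \<theta> l $ i"
  by (simp add: water_filling_def)

lemma water_filling_le_1: "water_filling K \<theta> l $ i \<le> 1"
  by (simp add: water_filling_def)

text \<open>These are the Karush-Kuhn-Tucker conditions with multiplier \<open>l\<close>: the
  left-hand side is the derivative of \<theta>_i (1 - (1 - x)^K) at the water-filling value.
  Clipping at 0 replaces the root \<open>r\<close> of the stationarity equation by
  \<open>min 1 r\<close>.\<close>

lemma water_filling_slope_le:
  assumes "K > 1" "l \<ge> 0" "\<theta> $ i > 0"
  shows "\<theta> $ i * K * (1 - water_filling K \<theta> l $ i) ^ (K - 1) \<le> l"
    and "water_filling K \<theta> l $ i > 0 \<Longrightarrow>
      \<theta> $ i * K * (1 - water_filling K \<theta> l $ i) ^ (K - 1) = l"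
proof -
  define r where "r = (l / (real K * \<theta> $ i)) powr (1 / (real K - 1))"
  \<comment> \<open>For \<open>l = 0\<close> the root is 0, since \<open>0 powr x = 0\<close>, and
    its power vanishes because \<open>K > 1\<close>.\<close>
  have "r ^ (K - 1) = l / (real K * \<theta> $ i)"
    using assms by (cases "l = 0") (auto simp: r_def powr_powr simp flip: powr_realpow')
  then have l: "\<theta> $ i * K * r ^ (K - 1) = l"
    using assms by simp
  have wf: "1 - water_filling K \<theta> l $ i = min 1 r"
    using assms by (simp add: water_filling_def r_def)
  have "min 1 r ^ (K - 1) \<le> r ^ (K - 1)"
    by (intro power_mono) (auto simp: r_def)
  then show "\<theta> $ i * K * (1 - water_filling K \<theta> l $ i) ^ (K - 1) \<le> l"
    using assms mult_left_mono[of "min 1 r ^ (K - 1)" "r ^ (K - 1)" "\<theta> $ i * K"]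
    unfolding wf l by simp
  show "\<theta> $ i * K * (1 - water_filling K \<theta> l $ i) ^ (K - 1) = l" if "water_filling K \<theta> l $ i > 0"
  proof -
    have "min 1 r = r"
      using that wf by linarith
    with l wf show ?thesis
      by simp
  qed
qed

text \<open>Replaces the channel's own tangent slope by the common multiplier \<open>l\<close>, so
  that the linear terms can later cancel across channels.\<close>

lemma water_filling_tangent:
  assumes "K > 1" "l \<ge> 0" "\<theta> $ i \<ge> 0" "0 \<le> y" "y \<le> 1"
  defines "x \<equiv> water_filling K \<theta> l $ i"
  shows "\<theta> $ i * (1 - (1 - y) ^ K) \<le> \<theta> $ i * (1 - (1 - x) ^ K) + l * (y - x)"
    and "\<theta> $ i > 0 \<Longrightarrow> y \<noteq> x \<Longrightarrow>
      \<theta> $ i * (1 - (1 - y) ^ K) < \<theta> $ i * (1 - (1 - x) ^ K) + l * (y - x)"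
proof -
  show strict: "\<theta> $ i * (1 - (1 - y) ^ K) < \<theta> $ i * (1 - (1 - x) ^ K) + l * (y - x)"
    if "\<theta> $ i > 0" "y \<noteq> x"
  proof -
    have "\<theta> $ i * (1 - (1 - y) ^ K)
        < \<theta> $ i * (1 - (1 - x) ^ K + K * (1 - x) ^ (K - 1) * (y - x))"
      using assms(1,5) that unfolding x_def
      by (intro mult_strict_left_mono power_complement_less_tangent water_filling_le_1) auto
    also have "\<dots> = \<theta> $ i * (1 - (1 - x) ^ K) + \<theta> $ i * K * (1 - x) ^ (K - 1) * (y - x)"
      by (simp add: algebra_simps)
    \<comment> \<open>At \<open>x = 0\<close> the slope is only bounded by \<open>l\<close>, but
      then \<open>y - x\<close> is nonnegative; for \<open>x > 0\<close> the slope equals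
      \<open>l\<close>.\<close>
    also have "\<theta> $ i * K * (1 - x) ^ (K - 1) * (y - x) \<le> l * (y - x)"
    proof (cases "x = 0")
      case True
      with water_filling_slope_le(1)[OF assms(1,2) that(1)] assms(4) show ?thesis
        unfolding x_def by (intro mult_right_mono) auto
    next
      case False
      then have "x > 0"
        using water_filling_nonneg[of K \<theta> l i] by (simp add: x_def)
      with water_filling_slope_le(2)[OF assms(1,2) that(1)] show ?thesis
        unfolding x_def by simp
    qed
    finally show ?thesis
      by simp
  qed
  show "\<theta> $ i * (1 - (1 - y) ^ K) \<le> \<theta> $ i * (1 - (1 - x) ^ K) + l * (y - x)"
  proof (cases "\<theta> $ i = 0")
    case True
    with assms(2,4) show ?thesis
      by (simp add: x_def water_filling_def)
  next
    case False
    with strict assms(3) show ?thesis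
      by (cases "y = x") auto
  qed
qed

lemma water_filling_unique_max:
  fixes \<theta> q :: "real ^ 'n"
  assumes "K > 1" "l \<ge> 0" "\<forall>i. 0 \<le> \<theta> $ i"
    and sum1: "(\<Sum>i\<in>UNIV. water_filling K \<theta> l $ i) = 1"
    and q: "q \<in> prob_vectors" "q \<noteq> water_filling K \<theta> l"
  shows "(\<Sum>i\<in>UNIV. \<theta> $ i * (1 - (1 - q $ i) ^ K))
       < (\<Sum>i\<in>UNIV. \<theta> $ i * (1 - (1 - water_filling K \<theta> l $ i) ^ K))"
proof -
  define w where "w = water_filling K \<theta> l"
  have q0: "0 \<le> q $ i" and q_sum: "(\<Sum>i\<in>UNIV. q $ i) = 1" for i
    using q(1) by (auto simp: prob_vectors_def)
  have q1: "q $ i \<le> 1" for i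
    using member_le_sum[of i UNIV "($) q"] q0 q_sum by simp
  \<comment> \<open>Strictness needs a difference on a channel with \<theta>_i > 0. If there were
    none, \<open>q\<close> would dominate \<open>w\<close>, which is 0 on the remaining channels;
    equal totals then force \<open>q = w\<close>.\<close>
  have "\<exists>i. \<theta> $ i > 0 \<and> q $ i \<noteq> w $ i"
  proof (rule ccontr)
    assume "\<not> ?thesis"
    then have eq: "q $ i = w $ i" if "\<theta> $ i > 0" for i
      using that by blast
    have le: "w $ i \<le> q $ i" for i
    proof (cases "\<theta> $ i > 0")
      case False
      then show ?thesis
        using q0 by (simp add: w_def water_filling_def)
    qed (simp add: eq)
    moreover have "(\<Sum>i\<in>UNIV. q $ i - w $ i) = 0"
      by (simp add: sum_subtractf q_sum sum1 w_def)
    ultimately have "q $ i = w $ i" for i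
      by (subst (asm) sum_nonneg_eq_0_iff) auto
    then show False
      using q(2) by (simp add: w_def vec_eq_iff)
  qed
  then obtain j where j: "\<theta> $ j > 0" "q $ j \<noteq> w $ j"
    by blast
  have "(\<Sum>i\<in>UNIV. \<theta> $ i * (1 - (1 - q $ i) ^ K))
      < (\<Sum>i\<in>UNIV. \<theta> $ i * (1 - (1 - w $ i) ^ K) + l * (q $ i - w $ i))"
  proof (rule sum_strict_mono_ex1)
    show "\<forall>i\<in>UNIV. \<theta> $ i * (1 - (1 - q $ i) ^ K)
        \<le> \<theta> $ i * (1 - (1 - w $ i) ^ K) + l * (q $ i - w $ i)"
      unfolding w_def using assms(1-3) q0 q1 by (intro ballI water_filling_tangent(1)) auto
    show "\<exists>i\<in>UNIV. \<theta> $ i * (1 - (1 - q $ i) ^ K)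
        < \<theta> $ i * (1 - (1 - w $ i) ^ K) + l * (q $ i - w $ i)"
      unfolding w_def using assms(1-3) q0 q1 j[unfolded w_def]
      by (intro bexI[of _ j] water_filling_tangent(2)) auto
  qed simp
  \<comment> \<open>Both vectors sum to 1, so the term with factor \<open>l\<close>
    vanishes.\<close>
  also have "\<dots> = (\<Sum>i\<in>UNIV. \<theta> $ i * (1 - (1 - w $ i) ^ K))
      + l * ((\<Sum>i\<in>UNIV. q $ i) - (\<Sum>i\<in>UNIV. w $ i))"
    by (simp add: sum.distrib sum_distrib_left sum_subtractf algebra_simps)
  finally show ?thesis
    by (simp add: q_sum sum1 w_def)
qed

section \<open>Existence of a water level\<close>

lemma continuous_on_water_filling:
  assumes "K > 1"
  shows "continuous_on {0..} (\<lambda>l. water_filling K \<theta> l $ i)"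
proof (cases "\<theta> $ i > 0")
  case True
  \<comment> \<open>Continuity extends to \<open>l = 0\<close>, where the base is 0, because the
    exponent is positive.\<close>
  have "continuous_on {0..} (\<lambda>l. (l / (real K * \<theta> $ i)) powr (1 / (real K - 1)))"
    using assms True by (intro continuous_on_powr' continuous_intros) auto
  then have "continuous_on {0..} (\<lambda>l. max 0 (1 - (l / (real K * \<theta> $ i)) powr (1 / (real K - 1))))"
    by (intro continuous_on_max continuous_on_diff continuous_on_const)
  with True show ?thesis
    by (simp add: water_filling_def)
qed (simp add: water_filling_def)

text \<open>Intermediate value theorem: the total is continuous in \<open>l\<close>, at least 1 at
  level 0, and 0 at a sufficiently high level.\<close>

lemma ex_water_level:
  fixes \<theta> :: "real ^ 'n"
  assumes "K > 1" and nonneg: "\<forall>i. 0 \<le> \<theta> $ i" and "\<exists>i. \<theta> $ i > 0"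
  shows "\<exists>l\<ge>0. (\<Sum>i\<in>UNIV. water_filling K \<theta> l $ i) = 1"
proof -
  obtain j where j: "\<theta> $ j > 0"
    using assms(3) by blast
  \<comment> \<open>Chosen so that \<open>M\<close> is at least K \<theta>_i for every channel,
    which clips every component to 0.\<close>
  define M where "M = real K * (\<Sum>i\<in>UNIV. \<theta> $ i)"
  have "M \<ge> 0"
    using nonneg by (simp add: M_def sum_nonneg)
  have "water_filling K \<theta> M $ i = 0" for i
  proof (cases "\<theta> $ i > 0")
    case True
    have "\<theta> $ i \<le> (\<Sum>i\<in>UNIV. \<theta> $ i)"
      using nonneg by (intro member_le_sum) auto
    then have "M / (real K * \<theta> $ i) \<ge> 1"
      using True assms(1) by (simp add: M_def)
    then have "(M / (real K * \<theta> $ i)) powr (1 / (real K - 1)) \<ge> 1"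
      using assms(1) by (intro ge_one_powr_ge_zero) auto
    then show ?thesis
      by (simp add: water_filling_def)
  qed (simp add: water_filling_def)
  then have "(\<Sum>i\<in>UNIV. water_filling K \<theta> M $ i) \<le> 1"
    by simp
  \<comment> \<open>At level 0 the power term is 0, so channel \<open>j\<close> alone contributes
    1.\<close>
  moreover have "1 \<le> (\<Sum>i\<in>UNIV. water_filling K \<theta> 0 $ i)"
    using member_le_sum[of j UNIV "\<lambda>i. water_filling K \<theta> 0 $ i"] j
    by (simp add: water_filling_def)
  moreover have "continuous_on {0..M} (\<lambda>l. \<Sum>i\<in>UNIV. water_filling K \<theta> l $ i)"
    by (intro continuous_on_sum continuous_on_subset[OF continuous_on_water_filling[OF assms(1)]]) auto
  ultimately show ?thesis
    using IVT2'[of "\<lambda>l. \<Sum>i\<in>UNIV. water_filling K \<theta> l $ i" M 1 0] \<open>M \<ge> 0\<close> by auto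
qed

theorem lemma6:
  fixes \<theta> :: "real ^ 'n" and B :: real and K T u :: nat
  assumes "K > 1" and "T > 0" and "B > 0"
    and "\<forall>i. 0 \<le> \<theta> $ i \<and> \<theta> $ i \<le> 1"
    and "\<exists>i. \<theta> $ i > 0"
    and "u < K"
  shows "(\<exists>l\<ge>0. (\<Sum>i\<in>UNIV. water_filling K \<theta> l $ i) = 1) \<and>
         (\<forall>l\<ge>0. (\<Sum>i\<in>UNIV. water_filling K \<theta> l $ i) = 1 \<longrightarrow>
            (\<forall>p. is_arg_max (throughput K T B \<theta> u) (\<lambda>q. q \<in> prob_vectors) p
                 \<longleftrightarrow> p = water_filling K \<theta> l))"
proof (intro conjI allI impI)
  show "\<exists>l\<ge>0. (\<Sum>i\<in>UNIV. water_filling K \<theta> l $ i) = 1"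
    using assms by (intro ex_water_level) auto
next
  fix l p
  assume l: "0 \<le> l" and sum1: "(\<Sum>i\<in>UNIV. water_filling K \<theta> l $ i) = 1"
  let ?w = "water_filling K \<theta> l"
  have w: "?w \<in> prob_vectors"
    using sum1 by (simp add: prob_vectors_def water_filling_nonneg)
  \<comment> \<open>The common factor \<open>T * B / K\<close> is positive, so the strict comparison
    of sums carries over. Strictness against every other \<open>q\<close> gives both maximality and
    uniqueness.\<close>
  have less: "throughput K T B \<theta> u q < throughput K T B \<theta> u ?w"
    if "q \<in> prob_vectors" "q \<noteq> ?w" for q
    unfolding throughput_eq[OF that(1) assms(6,4)] throughput_eq[OF w assms(6,4)]
    using assms l sum1 that by (intro mult_strict_left_mono water_filling_unique_max) auto
  show "is_arg_max (throughput K T B \<theta> u) (\<lambda>q. q \<in> prob_vectors) p \<longleftrightarrow> p = ?w"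
    using w less unfolding is_arg_max_def by (metis less_asym less_irrefl)
qed

end
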